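(* Let $\mathcal{I}$ be a compositional graphoid over a finite set $V$, and let $A,B,C$ be disjoint subsets of $V$. Then $A\perp\!\!\!\perp B\mid C$ if and only if $$C\in\bigcap_{a\in A}\bigcap_{b\in B}\mathfrak{T}_a(C\cup\{b\}),$$ or equivalently, if and only if $$\bigcup_{a\in A}\bigcup_{b\in B}m(a;C\cup\{b\})\subseteq C.$$
   Context: Notation: $V_{-j}=V\setminus\{j\}$; braces of singletons are dropped and juxtaposition denotes union ($BD=B\cup D$). Membership of $C$ in an intersection over an empty index set is regarded as vacuously true. An independence model over $V$ is a ternary relation $A\perp\!\!\!\perp B\mid C$ on pairwise disjoint subsets $A,B,C\subseteq V$. It is a graphoid if, for all pairwise disjoint $A,B,C,D\subseteq V$: (G1) $A\perp\!\!\!\perp\emptyset\mid C$; (G2) $A\perp\!\!\!\perp B\mid C\Rightarrow B\perp\!\!\!\perp A\mid C$; (G3) $A\perp\!\!\!\perp BD\mid C\Rightarrow A\perp\!\!\!\perp B\mid C$ and $A\perp\!\!\!\perp D\mid C$; (G4) $A\perp\!\!\!\perp BD\mid C\Rightarrow A\perp\!\!\!\perp B\mid CD$; (G5) $A\perp\!\!\!\perp B\mid C$ and $A\perp\!\!\!\perp D\mid BC\Rightarrow A\perp\!\!\!\perp BD\mid C$; (G6) $A\perp\!\!\!\perp B\mid CD$ and $A\perp\!\!\!\perp C\mid BD\Rightarrow A\perp\!\!\!\perp BC\mid D$. It is a compositional graphoid if moreover (G7) $A\perp\!\!\!\perp B\mid C$ and $A\perp\!\!\!\perp D\mid C\Rightarrow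 A\perp\!\!\!\perp BD\mid C$. For $j\in V$ and $S\subseteq V_{-j}$, the relative Markov boundary is $m(j;S)=\bigcap\{U\subseteq S:\ j\perp\!\!\!\perp S\setminus U\mid U\}$, and the neighbourhood lattice of $j$ relative to $S$ is $\mathfrak{T}_j(S)=\{U\subseteq V_{-j}:\ m(j;U)=m(j;S)\}$. *)

theory Defs
  imports Main
begin

text \<open>
  Disjointness is between positions of the list: the same set may occur twice only if it is
  empty. In particular any number of the listed sets may be empty.
\<close>

definition disjoint_subsets :: "'a set \<Rightarrow> 'a set list \<Rightarrow> bool" where
  "disjoint_subsets V Xs \<longleftrightarrow> (\<forall>X\<in>set Xs. X \<subseteq> V) \<and> sorted_wrt disjnt Xs"

text \<open>
  \<open>I A B C\<close> stands for the statement that \<open>A\<close> is independent of \<open>B\<close> given \<open>C\<close>. A relation on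
  triples of pairwise disjoint subsets of \<open>V\<close> is represented by a total predicate which is false
  on all other triples.
\<close>

locale independence_model =
  fixes V :: "'a set" and I :: "'a set \<Rightarrow> 'a set \<Rightarrow> 'a set \<Rightarrow> bool"
  assumes domain: "I A B C \<Longrightarrow> disjoint_subsets V [A, B, C]"

locale graphoid = independence_model +
  assumes triviality:
      "disjoint_subsets V [A, C] \<Longrightarrow> I A {} C"
    and symmetry:
      "\<lbrakk>disjoint_subsets V [A, B, C]; I A B C\<rbrakk> \<Longrightarrow> I B A C"
    and decomposition:
      "\<lbrakk>disjoint_subsets V [A, B, C, D]; I A (B \<union> D) C\<rbrakk> \<Longrightarrow> I A B C \<and> I A D C"
    and weak_union:
      "\<lbrakk>disjoint_subsets V [A, B, C, D]; I A (B \<union> D) C\<rbrakk> \<Longrightarrow> I A B (C \<union> D)"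
    and contraction:
      "\<lbrakk>disjoint_subsets V [A, B, C, D]; I A B C; I A D (B \<union> C)\<rbrakk> \<Longrightarrow> I A (B \<union> D) C"
    and intersection:
      "\<lbrakk>disjoint_subsets V [A, B, C, D]; I A B (C \<union> D); I A C (B \<union> D)\<rbrakk> \<Longrightarrow> I A (B \<union> C) D"

locale compositional_graphoid = graphoid +
  assumes composition:
      "\<lbrakk>disjoint_subsets V [A, B, C, D]; I A B C; I A D C\<rbrakk> \<Longrightarrow> I A (B \<union> D) C"

text \<open>
  The next two notions are meant for \<open>j \<in> V\<close> and \<open>S \<subseteq> V - {j}\<close>. In a graphoid the family
  intersected below is then nonempty, as it contains \<open>S\<close>.
\<close>

definition rel_markov_boundary ::
  "('a set \<Rightarrow> 'a set \<Rightarrow> 'a set \<Rightarrow> bool) \<Rightarrow> 'a \<Rightarrow> 'a set \<Rightarrow> 'a set" where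
  "rel_markov_boundary I j S = \<Inter>{U. U \<subseteq> S \<and> I {j} (S - U) U}"

definition nbhd_lattice ::
  "'a set \<Rightarrow> ('a set \<Rightarrow> 'a set \<Rightarrow> 'a set \<Rightarrow> bool) \<Rightarrow> 'a \<Rightarrow> 'a set \<Rightarrow> 'a set set" where
  "nbhd_lattice V I j S =
     {U. U \<subseteq> V - {j} \<and> rel_markov_boundary I j U = rel_markov_boundary I j S}"

end

theory Submission
  imports Defs
begin

text \<open>
  In a graphoid the sets \<open>U \<subseteq> S\<close> separating \<open>j\<close> from \<open>S - U\<close> are closed under intersection, so over
  a finite ground set the relative Markov boundary \<open>m(j;S)\<close> is itself the least such set. Taking
  \<open>S = C \<union> {b}\<close>, the set \<open>C\<close> separates \<open>a\<close> from \<open>b\<close> iff \<open>m(a; C \<union> {b}) \<subseteq> C\<close>, and in that case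
  adding \<open>b\<close> to \<open>C\<close> does not change the boundary. Composition reduces the independence of two sets
  to that of their elements.
\<close>

context independence_model
begin

lemma indep_subsets:
  assumes "I A B C"
  shows "A \<subseteq> V" "B \<subseteq> V" "C \<subseteq> V" "A \<inter> B = {}" "A \<inter> C = {}" "B \<inter> C = {}"
  using domain[OF assms] by (auto simp: disjoint_subsets_def disjnt_def)

end

context graphoid
begin

lemma indep_sym: "I A B C \<Longrightarrow> I B A C"
  using symmetry domain by blast

lemma indep_empty: "A \<subseteq> V \<Longrightarrow> C \<subseteq> V \<Longrightarrow> A \<inter> C = {} \<Longrightarrow> I A {} C"
  by (rule triviality) (auto simp: disjoint_subsets_def disjnt_def)

lemma indep_mono:
  assumes "I A B C" "B' \<subseteq> B"
  shows "I A B' C"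
proof -
  have "disjoint_subsets V [A, B', C, B - B']"
    using indep_subsets[OF assms(1)] assms(2) by (auto simp: disjoint_subsets_def disjnt_def)
  moreover have "B' \<union> (B - B') = B"
    using assms(2) by blast
  ultimately show ?thesis
    using decomposition assms(1) by metis
qed

lemma indep_weak_union:
  assumes "I A B C" "B' \<subseteq> B" "D \<subseteq> B" "B' \<inter> D = {}"
  shows "I A B' (C \<union> D)"
proof (rule weak_union)
  show "disjoint_subsets V [A, B', C, D]"
    using indep_subsets[OF assms(1)] assms(2-4) by (auto simp: disjoint_subsets_def disjnt_def)
  show "I A (B' \<union> D) C"
    using assms by (intro indep_mono[OF assms(1)]) auto
qed

lemma indep_contraction:
  assumes "I A B C" "I A D (B \<union> C)"
  shows "I A (B \<union> D) C"
  using indep_subsets[OF assms(1)] indep_subsets[OF assms(2)] assms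
  by (intro contraction) (auto simp: disjoint_subsets_def disjnt_def)

lemma indep_intersection:
  assumes "I A B (C \<union> D)" "I A C (B \<union> D)" "C \<inter> D = {}"
  shows "I A (B \<union> C) D"
  using indep_subsets[OF assms(1)] indep_subsets[OF assms(2)] assms
  by (intro intersection) (auto simp: disjoint_subsets_def disjnt_def)

text \<open>Split \<open>S - U \<inter> W\<close> into \<open>W - U\<close>, \<open>U - W\<close>
  and the points outside \<open>U \<union> W\<close>. Given \<open>U\<close>, that is, given
  \<open>U - W\<close> and \<open>U \<inter> W\<close>, \<open>A\<close> is independent of
  \<open>W - U\<close>, and symmetrically for \<open>W\<close>, so the intersection axiom handles
  the first two pieces. Weak union separates \<open>A\<close> from the third piece given
  \<open>U \<union> W\<close>, and contraction joins it to the others.\<close>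

lemma indep_separator_Int:
  assumes U: "U \<subseteq> S" "I A (S - U) U" and W: "W \<subseteq> S" "I A (S - W) W"
  shows "I A (S - U \<inter> W) (U \<inter> W)"
proof -
  have "I A (W - U) ((U - W) \<union> (U \<inter> W))"
    using indep_mono[OF U(2), of "W - U"] W(1) by (simp add: Diff_mono Un_Diff_Int)
  moreover have "I A (U - W) ((W - U) \<union> (U \<inter> W))"
    using indep_mono[OF W(2), of "U - W"] U(1)
    by (simp add: Diff_mono Un_Diff_Int Int_commute[of U])
  ultimately have "I A ((W - U) \<union> (U - W)) (U \<inter> W)"
    by (rule indep_intersection) blast
  moreover have "I A (S - (U \<union> W)) (U \<union> (W - U))"
    using W(1) by (intro indep_weak_union[OF U(2)]) auto
  then have "I A (S - (U \<union> W)) (((W - U) \<union> (U - W)) \<union> (U \<inter> W))"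
    by (rule back_subst[of "I A (S - (U \<union> W))"]) blast
  ultimately have "I A (((W - U) \<union> (U - W)) \<union> (S - (U \<union> W))) (U \<inter> W)"
    by (rule indep_contraction)
  moreover have "((W - U) \<union> (U - W)) \<union> (S - (U \<union> W)) = S - U \<inter> W"
    using U(1) W(1) by blast
  ultimately show ?thesis by simp
qed

lemma rel_markov_boundary_least:
  "U \<subseteq> S \<Longrightarrow> I {j} (S - U) U \<Longrightarrow> rel_markov_boundary I j S \<subseteq> U"
  by (auto simp: rel_markov_boundary_def)

lemma rel_markov_boundary_separates:
  assumes "finite S" "j \<in> V" "S \<subseteq> V - {j}"
  shows "rel_markov_boundary I j S \<subseteq> S \<and>
    I {j} (S - rel_markov_boundary I j S) (rel_markov_boundary I j S)"
proof -
  define F where "F = {U. U \<subseteq> S \<and> I {j} (S - U) U}"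
  have "S \<in> F"
    using assms indep_empty[of "{j}" S] by (auto simp: F_def)
  \<comment> \<open>The empty intersection is \<open>UNIV\<close>, which is not in \<open>F\<close>
    because \<open>j \<notin> S\<close>; this is why \<open>S \<in> F\<close> is needed as
    well.\<close>
  have closed: "\<Inter>G \<in> F" if "finite G" "G \<noteq> {}" "G \<subseteq> F" for G
    using that
  proof (induction rule: finite_ne_induct)
    case (insert U G)
    then show ?case
      using indep_separator_Int[of U S "{j}" "\<Inter>G"] by (auto simp: F_def)
  qed simp
  have "finite F"
    by (rule finite_subset[of _ "Pow S"]) (auto simp: F_def assms(1))
  then have "\<Inter>F \<in> F"
    using closed \<open>S \<in> F\<close> by blast
  then show ?thesis
    by (simp add: F_def rel_markov_boundary_def)
qed

text \<open>If independence holds, \<open>C\<close> is one of the sets intersected in the boundary.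
  Conversely, a boundary \<open>M\<close> inside \<open>C\<close> separates \<open>a\<close> from
  both \<open>b\<close> and \<open>C - M\<close>, and weak union moves \<open>C - M\<close> into the
  conditioning set.\<close>

lemma indep_iff_rel_markov_boundary_subset:
  assumes "finite C" "a \<in> V" "b \<in> V" "C \<subseteq> V" "a \<notin> C" "b \<notin> C" "a \<noteq> b"
  shows "I {a} {b} C \<longleftrightarrow> rel_markov_boundary I a (C \<union> {b}) \<subseteq> C"
proof
  assume "I {a} {b} C"
  moreover have "C \<union> {b} - C = {b}"
    using assms(6) by blast
  ultimately show "rel_markov_boundary I a (C \<union> {b}) \<subseteq> C"
    by (intro rel_markov_boundary_least) auto
next
  define M where "M = rel_markov_boundary I a (C \<union> {b})"
  assume "rel_markov_boundary I a (C \<union> {b}) \<subseteq> C"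
  then have "M \<subseteq> C" by (simp add: M_def)
  have "I {a} (C \<union> {b} - M) M"
    unfolding M_def using assms by (intro rel_markov_boundary_separates[THEN conjunct2]) auto
  then have "I {a} {b} (M \<union> (C - M))"
    by (rule indep_weak_union) (use \<open>M \<subseteq> C\<close> assms(6) in auto)
  moreover have "M \<union> (C - M) = C"
    using \<open>M \<subseteq> C\<close> by blast
  ultimately show "I {a} {b} C" by simp
qed

lemma nbhd_lattice_insert_iff:
  assumes "finite C" "a \<in> V" "b \<in> V" "C \<subseteq> V" "a \<notin> C" "b \<notin> C" "a \<noteq> b"
  shows "C \<in> nbhd_lattice V I a (C \<union> {b}) \<longleftrightarrow> rel_markov_boundary I a (C \<union> {b}) \<subseteq> C"
proof -
  let ?M = "rel_markov_boundary I a (C \<union> {b})" and ?N = "rel_markov_boundary I a C"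
  have M: "I {a} (C \<union> {b} - ?M) ?M"
    using assms by (intro rel_markov_boundary_separates[THEN conjunct2]) auto
  have N: "?N \<subseteq> C" "I {a} (C - ?N) ?N"
    using assms rel_markov_boundary_separates[of C a] by auto
  have "?N = ?M" if "?M \<subseteq> C"
  proof
    \<comment> \<open>Since \<open>?M\<close> separates \<open>a\<close> from the rest of
      \<open>C \<union> {b}\<close>, it does so from the rest of \<open>C\<close>.\<close>
    show "?N \<subseteq> ?M"
      using that by (intro rel_markov_boundary_least[OF that] indep_mono[OF M]) auto
    \<comment> \<open>Conversely, \<open>?N\<close> separates \<open>a\<close> from
      \<open>C - ?N\<close>, and \<open>C\<close> separates \<open>a\<close> from \<open>b\<close>.
      Writing \<open>C\<close> as \<open>(C - ?N) \<union> ?N\<close> lets contraction show that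
      \<open>?N\<close> separates \<open>a\<close> from the rest of
      \<open>C \<union> {b}\<close>.\<close>
    have "I {a} {b} ((C - ?N) \<union> ?N)"
      using that indep_iff_rel_markov_boundary_subset[OF assms] N(1) by (simp add: Un_absorb2)
    with N(2) have "I {a} ((C - ?N) \<union> {b}) ?N"
      by (rule indep_contraction)
    moreover have "(C - ?N) \<union> {b} = C \<union> {b} - ?N"
      using N(1) assms(6) by blast
    ultimately show "?M \<subseteq> ?N"
      using N(1) by (intro rel_markov_boundary_least[of ?N]) auto
  qed
  with N(1) assms(4,5) show ?thesis
    by (auto simp: nbhd_lattice_def)
qed

end

context compositional_graphoid
begin

text \<open>The axiom asks for disjoint \<open>B\<close> and \<open>D\<close>, so it is applied to
  \<open>B\<close> and \<open>D - B\<close>.\<close>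

lemma indep_composition:
  assumes "I A B C" "I A D C"
  shows "I A (B \<union> D) C"
proof -
  have "I A (B \<union> (D - B)) C"
    using indep_subsets[OF assms(1)] indep_subsets[OF assms(2)] assms(1)
      indep_mono[OF assms(2), of "D - B"]
    by (intro composition) (auto simp: disjoint_subsets_def disjnt_def)
  then show ?thesis by simp
qed

text \<open>The conditions on \<open>A\<close> and \<open>C\<close> serve the case of empty
  \<open>B\<close>, where the right side is vacuous and triviality must supply the left.\<close>

lemma indep_iff_right_singletons:
  assumes "finite B" "A \<subseteq> V" "C \<subseteq> V" "A \<inter> C = {}"
  shows "I A B C \<longleftrightarrow> (\<forall>b\<in>B. I A {b} C)"
proof
  assume "\<forall>b\<in>B. I A {b} C"
  with assms(1) show "I A B C"
  proof (induction rule: finite_induct)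
    case empty
    then show ?case using assms indep_empty by blast
  next
    case (insert b B)
    then show ?case using indep_composition[of A "{b}" C B] by simp
  qed
qed (auto intro: indep_mono)

text \<open>Composition acts on the second argument only; symmetry carries the reduction over to the
  first.\<close>

lemma indep_iff_singletons:
  assumes "finite A" "finite B" "disjoint_subsets V [A, B, C]"
  shows "I A B C \<longleftrightarrow> (\<forall>a\<in>A. \<forall>b\<in>B. I {a} {b} C)"
proof -
  have sub: "A \<subseteq> V" "B \<subseteq> V" "C \<subseteq> V" "A \<inter> C = {}" "B \<inter> C = {}"
    using assms(3) by (auto simp: disjoint_subsets_def disjnt_def)
  have sym: "I X Y C \<longleftrightarrow> I Y X C" for X Y
    using indep_sym by blast
  have "I A B C \<longleftrightarrow> (\<forall>b\<in>B. I A {b} C)"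
    using assms sub by (intro indep_iff_right_singletons)
  also have "\<dots> \<longleftrightarrow> (\<forall>b\<in>B. \<forall>a\<in>A. I {b} {a} C)"
  proof (rule ball_cong[OF refl])
    fix b assume "b \<in> B"
    then have "I {b} A C \<longleftrightarrow> (\<forall>a\<in>A. I {b} {a} C)"
      using assms(1) sub by (intro indep_iff_right_singletons) auto
    then show "I A {b} C \<longleftrightarrow> (\<forall>a\<in>A. I {b} {a} C)"
      using sym by blast
  qed
  also have "\<dots> \<longleftrightarrow> (\<forall>a\<in>A. \<forall>b\<in>B. I {a} {b} C)"
    using sym by blast
  finally show ?thesis .
qed

end

theorem corollary3p4:
  fixes V A B C :: "'a set" and I :: "'a set \<Rightarrow> 'a set \<Rightarrow> 'a set \<Rightarrow> bool"
  assumes "finite V"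
    and "compositional_graphoid V I"
    and "disjoint_subsets V [A, B, C]"
  shows "(I A B C \<longleftrightarrow> C \<in> (\<Inter>a\<in>A. \<Inter>b\<in>B. nbhd_lattice V I a (C \<union> {b}))) \<and>
         (I A B C \<longleftrightarrow> (\<Union>a\<in>A. \<Union>b\<in>B. rel_markov_boundary I a (C \<union> {b})) \<subseteq> C)"
proof -
  interpret compositional_graphoid V I by fact
  have sub: "A \<subseteq> V" "B \<subseteq> V" "C \<subseteq> V" "A \<inter> B = {}" "A \<inter> C = {}" "B \<inter> C = {}"
    using assms(3) by (auto simp: disjoint_subsets_def disjnt_def)
  have fin: "finite A" "finite B" "finite C"
    using sub(1-3)[THEN finite_subset] assms(1) by simp_all
  have pair: "I {a} {b} C \<longleftrightarrow> rel_markov_boundary I a (C \<union> {b}) \<subseteq> C"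
    "C \<in> nbhd_lattice V I a (C \<union> {b}) \<longleftrightarrow> rel_markov_boundary I a (C \<union> {b}) \<subseteq> C"
    if "a \<in> A" "b \<in> B" for a b
    using that sub fin
    by (intro indep_iff_rel_markov_boundary_subset nbhd_lattice_insert_iff; blast)+
  have "I A B C \<longleftrightarrow> (\<forall>a\<in>A. \<forall>b\<in>B. rel_markov_boundary I a (C \<union> {b}) \<subseteq> C)"
    using indep_iff_singletons[OF fin(1,2) assms(3)] pair(1) by simp
  \<comment> \<open>For empty \<open>A\<close> or \<open>B\<close> the intersection is
    \<open>UNIV\<close>, so membership holds vacuously, like the bounded quantifiers.\<close>
  moreover have "C \<in> (\<Inter>a\<in>A. \<Inter>b\<in>B. nbhd_lattice V I a (C \<union> {b})) \<longleftrightarrow>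
      (\<forall>a\<in>A. \<forall>b\<in>B. rel_markov_boundary I a (C \<union> {b}) \<subseteq> C)"
    using pair(2) by simp
  ultimately show ?thesis by (simp add: UN_subset_iff)
qed

end
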